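(* Let $\mathbf{Iso}$ be the category with exactly two objects $x,y$ and exactly one arrow in each of its four hom-sets; write $\alpha\colon x\to y$ and $\beta\colon y\to x$ for the two non-identity arrows. Let $\mathbf{Cat}$ be the 2-category of categories, functors and natural transformations. Then a lax functor $\mathbf{Iso}\to\mathbf{Cat}$ is precisely a Morita context. Explicitly, sending a lax functor $(A,t,\mu,\eta)\colon\mathbf{Iso}\to\mathbf{Cat}$ to the data consisting of - the categories $A_x$, $A_y$, with the monads $(t_x,\mu_{x,x},\eta_x)$ on $A_x$ and $(t_y,\mu_{y,y},\eta_y)$ on $A_y$, - the functors $f=t_\alpha\colon A_x\to A_y$ and $g=t_\beta\colon A_y\to A_x$, - the natural transformations $\rho_f=\mu_{\alpha,y}\colon t_yf\to f$, $\lambda_f=\mu_{x,\alpha}\colon ft_x\to f$, $\rho_g=\mu_{y,\beta}\colon gt_y\to g$, $\lambda_g=\mu_{\beta,x}\colon t_xg\to g$, $\epsilon_x=\mu_{\alpha,\beta}\colon gf\to t_x$ and $\epsilon_y=\mu_{\beta,\alpha}\colon fg\to t_y$ defines a bijection between lax functors $\mathbf{Iso}\to\mathbf{Cat}$ and Morita contexts.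
   Context: Identity arrows are denoted by the name of the object, so $t_x$ means $t_{1_x}$, and $\mu_{x,\alpha}$ means $\mu_{1_x,\alpha}$, etc. Composites of functors are written by juxtaposition in the usual right-to-left order. **Lax functor.** A lax functor from a category $X$ to $\mathbf{Cat}$ consists of: for each object $x\in X$ a category $A_x$; for each arrow $\xi\colon x\to y$ of $X$ a functor $t_\xi\colon A_x\to A_y$; for each composable pair $\xi\colon x\to y$, $\zeta\colon y\to z$ a natural transformation $\mu_{\xi,\zeta}\colon t_\zeta t_\xi\to t_{\zeta\xi}$; and for each object $x$ a natural transformation $\eta_x\colon 1_{A_x}\to t_{1_x}$; such that for all composable $\xi,\zeta,\tau$ one has $\mu_{\xi,\tau\zeta}\circ(\mu_{\zeta,\tau}t_\xi)=\mu_{\zeta\xi,\tau}\circ(t_\tau\mu_{\xi,\zeta})\colon t_\tau t_\zeta t_\xi\to t_{\tau\zeta\xi}$, and for all $\xi\colon x\to y$ one has $\mu_{1_x,\xi}\circ(t_\xi\eta_x)=1_{t_\xi}$ and $\mu_{\xi,1_y}\circ(\eta_y t_\xi)=1_{t_\xi}$. **Morita context.** A Morita context consists of categories $A_x,A_y$; a monad $(t_x,\mu^x,\eta^x)$ on $A_x$ and a monad $(t_y,\mu^y,\eta^y)$ on $A_y$; functors $f\colon A_x\to A_y$ and $g\colon A_y\to A_x$; and natural transformations $\rho_f\colon t_yf\to f$, $\lambda_f\colon ft_x\to f$, $\rho_g\colon gt_y\to g$, $\lambda_g\colon t_xg\to g$, $\epsilon_x\colon gf\to t_x$, $\epsilon_y\colon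 fg\to t_y$, such that: 1. $f$ is a bimodule: $\rho_f$ is an (associative and unital) left action of the monad $t_y$ on $f$, $\lambda_f$ is an (associative and unital) right action of the monad $t_x$ on $f$, and the two actions commute: $\lambda_f\circ(\rho_ft_x)=\rho_f\circ(t_y\lambda_f)\colon t_yft_x\to f$. 2. $g$ is a bimodule: $\lambda_g$ is an (associative and unital) left action of $t_x$ on $g$, $\rho_g$ is an (associative and unital) right action of $t_y$ on $g$, and the two actions commute: $\rho_g\circ(\lambda_gt_y)=\lambda_g\circ(t_x\rho_g)\colon t_xgt_y\to g$. 3. $\epsilon_x$ is a bimodule morphism: $\epsilon_x\circ(\lambda_gf)=\mu^x\circ(t_x\epsilon_x)\colon t_xgf\to t_x$ and $\epsilon_x\circ(g\lambda_f)=\mu^x\circ(\epsilon_xt_x)\colon gft_x\to t_x$; and it is $t_y$-balanced: $\epsilon_x\circ(\rho_gf)=\epsilon_x\circ(g\rho_f)\colon gt_yf\to t_x$. 4. $\epsilon_y$ is a bimodule morphism: $\epsilon_y\circ(\rho_fg)=\mu^y\circ(t_y\epsilon_y)\colon t_yfg\to t_y$ and $\epsilon_y\circ(f\rho_g)=\mu^y\circ(\epsilon_yt_y)\colon fgt_y\to t_y$; and it is $t_x$-balanced: $\epsilon_y\circ(\lambda_fg)=\epsilon_y\circ(f\lambda_g)\colon ft_xg\to t_y$. 5. $\rho_f\circ(\epsilon_yf)=\lambda_f\circ(f\epsilon_x)\colon fgf\to f$ and $\lambda_g\circ(\epsilon_xg)=\rho_g\circ(g\epsilon_y)\colon gfg\to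 g$. *)

theory Defs
  imports "HOL-Library.FuncSet"
begin

section \<open>Categories, functors and natural transformations\<close>

text \<open>
  All data are extensional: functions take the value \<^term>\<open>undefined\<close> outside their domain,
  so that HOL equality of functors, transformations, lax functors and so on is their
  mathematical equality.
\<close>

record ('o, 'm) cat =
  obj :: "'o set"
  arr :: "'m set"
  src :: "'m \<Rightarrow> 'o"
  tgt :: "'m \<Rightarrow> 'o"
  ident :: "'o \<Rightarrow> 'm"
  comp :: "'m \<Rightarrow> 'm \<Rightarrow> 'm"  (infixr "\<cdot>\<index>" 70)

text \<open>Composition is in the right-to-left order: \<open>g \<cdot> f\<close> is defined when \<open>tgt f = src g\<close>.\<close>

locale category =
  fixes C :: "('o, 'm) cat" (structure)
  assumes src_mem: "src C \<in> arr C \<rightarrow>\<^sub>E obj C"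
    and tgt_mem: "tgt C \<in> arr C \<rightarrow>\<^sub>E obj C"
    and ident_mem: "ident C \<in> obj C \<rightarrow>\<^sub>E arr C"
    and src_ident: "a \<in> obj C \<Longrightarrow> src C (ident C a) = a"
    and tgt_ident: "a \<in> obj C \<Longrightarrow> tgt C (ident C a) = a"
    and comp_mem: "\<lbrakk>f \<in> arr C; g \<in> arr C; tgt C f = src C g\<rbrakk> \<Longrightarrow> g \<cdot> f \<in> arr C"
    and src_comp: "\<lbrakk>f \<in> arr C; g \<in> arr C; tgt C f = src C g\<rbrakk> \<Longrightarrow> src C (g \<cdot> f) = src C f"
    and tgt_comp: "\<lbrakk>f \<in> arr C; g \<in> arr C; tgt C f = src C g\<rbrakk> \<Longrightarrow> tgt C (g \<cdot> f) = tgt C g"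
    and comp_ident_right: "f \<in> arr C \<Longrightarrow> f \<cdot> ident C (src C f) = f"
    and comp_ident_left: "f \<in> arr C \<Longrightarrow> ident C (tgt C f) \<cdot> f = f"
    and comp_assoc:
      "\<lbrakk>f \<in> arr C; g \<in> arr C; h \<in> arr C; tgt C f = src C g; tgt C g = src C h\<rbrakk>
        \<Longrightarrow> (h \<cdot> g) \<cdot> f = h \<cdot> (g \<cdot> f)"
    and comp_undefined:
      "\<not> (f \<in> arr C \<and> g \<in> arr C \<and> tgt C f = src C g) \<Longrightarrow> g \<cdot> f = undefined"

record ('o, 'm) cfun =
  fobj :: "'o \<Rightarrow> 'o"
  farr :: "'m \<Rightarrow> 'm"

locale cat_functor = A: category A + B: category B
  for A B :: "('o, 'm) cat" +
  fixes F :: "('o, 'm) cfun"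
  assumes fobj_mem: "fobj F \<in> obj A \<rightarrow>\<^sub>E obj B"
    and farr_mem: "farr F \<in> arr A \<rightarrow>\<^sub>E arr B"
    and src_farr: "f \<in> arr A \<Longrightarrow> src B (farr F f) = fobj F (src A f)"
    and tgt_farr: "f \<in> arr A \<Longrightarrow> tgt B (farr F f) = fobj F (tgt A f)"
    and farr_ident: "a \<in> obj A \<Longrightarrow> farr F (ident A a) = ident B (fobj F a)"
    and farr_comp: "\<lbrakk>f \<in> arr A; g \<in> arr A; tgt A f = src A g\<rbrakk>
          \<Longrightarrow> farr F (g \<cdot>\<^bsub>A\<^esub> f) = farr F g \<cdot>\<^bsub>B\<^esub> farr F f"

text \<open>A transformation is represented by its family of components.\<close>

locale nat_trans = F: cat_functor A B F + G: cat_functor A B G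
  for A B :: "('o, 'm) cat" and F G :: "('o, 'm) cfun" +
  fixes \<sigma> :: "'o \<Rightarrow> 'm"
  assumes component_mem: "\<sigma> \<in> obj A \<rightarrow>\<^sub>E arr B"
    and src_component: "a \<in> obj A \<Longrightarrow> src B (\<sigma> a) = fobj F a"
    and tgt_component: "a \<in> obj A \<Longrightarrow> tgt B (\<sigma> a) = fobj G a"
    and naturality: "f \<in> arr A \<Longrightarrow>
          \<sigma> (tgt A f) \<cdot>\<^bsub>B\<^esub> farr F f = farr G f \<cdot>\<^bsub>B\<^esub> \<sigma> (src A f)"

definition id_fun :: "('o, 'm) cat \<Rightarrow> ('o, 'm) cfun" where
  "id_fun A = \<lparr>fobj = (\<lambda>a\<in>obj A. a), farr = (\<lambda>f\<in>arr A. f)\<rparr>"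

text \<open>
  In the following operations \<open>A\<close> is the category on which the result is defined, and \<open>B\<close>
  the category in which it takes its values.  For functors \<open>F\<close>, \<open>G\<close> and transformations
  \<open>\<sigma>\<close>, \<open>\<tau>\<close>, these are \<open>GF\<close>, \<open>1\<^sub>F\<close>, \<open>\<tau> \<circ> \<sigma>\<close>, \<open>G\<sigma>\<close> and \<open>\<sigma>F\<close>.
\<close>

definition comp_fun :: "('o, 'm) cat \<Rightarrow> ('o, 'm) cfun \<Rightarrow> ('o, 'm) cfun \<Rightarrow> ('o, 'm) cfun" where
  "comp_fun A G F =
    \<lparr>fobj = (\<lambda>a\<in>obj A. fobj G (fobj F a)), farr = (\<lambda>f\<in>arr A. farr G (farr F f))\<rparr>"

definition id_trans ::
    "('o, 'm) cat \<Rightarrow> ('o, 'm) cat \<Rightarrow> ('o, 'm) cfun \<Rightarrow> ('o \<Rightarrow> 'm)" where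
  "id_trans A B F = (\<lambda>a\<in>obj A. ident B (fobj F a))"

definition vcomp ::
    "('o, 'm) cat \<Rightarrow> ('o, 'm) cat \<Rightarrow> ('o \<Rightarrow> 'm) \<Rightarrow> ('o \<Rightarrow> 'm) \<Rightarrow> ('o \<Rightarrow> 'm)" where
  "vcomp A B \<tau> \<sigma> = (\<lambda>a\<in>obj A. \<tau> a \<cdot>\<^bsub>B\<^esub> \<sigma> a)"

definition whisker_left ::
    "('o, 'm) cat \<Rightarrow> ('o, 'm) cfun \<Rightarrow> ('o \<Rightarrow> 'm) \<Rightarrow> ('o \<Rightarrow> 'm)" where
  "whisker_left A G \<sigma> = (\<lambda>a\<in>obj A. farr G (\<sigma> a))"

definition whisker_right ::
    "('o, 'm) cat \<Rightarrow> ('o \<Rightarrow> 'm) \<Rightarrow> ('o, 'm) cfun \<Rightarrow> ('o \<Rightarrow> 'm)" where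
  "whisker_right A \<sigma> F = (\<lambda>a\<in>obj A. \<sigma> (fobj F a))"


section \<open>Lax functors to Cat\<close>

text \<open>
  The 2-category Cat consists of the categories with objects in the type \<open>'o\<close> and arrows in
  the type \<open>'m\<close>; these type variables play the role of the universe.
  The transformation \<open>\<mu>\<^bsub>\<xi>,\<zeta>\<^esub>\<close> is \<open>\<mu> \<xi> \<zeta>\<close>, with the arrow that is applied first as first argument.
\<close>

locale lax_functor = X: category X
  for X :: "('x, 'a) cat" +
  fixes A :: "'x \<Rightarrow> ('o, 'm) cat"
    and t :: "'a \<Rightarrow> ('o, 'm) cfun"
    and \<mu> :: "'a \<Rightarrow> 'a \<Rightarrow> 'o \<Rightarrow> 'm"
    and \<eta> :: "'x \<Rightarrow> 'o \<Rightarrow> 'm"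
  assumes A_ext: "A \<in> extensional (obj X)"
    and t_ext: "t \<in> extensional (arr X)"
    and \<mu>_ext: "\<not> (\<xi> \<in> arr X \<and> \<zeta> \<in> arr X \<and> tgt X \<xi> = src X \<zeta>) \<Longrightarrow> \<mu> \<xi> \<zeta> = undefined"
    and \<eta>_ext: "\<eta> \<in> extensional (obj X)"
    and A_category: "x \<in> obj X \<Longrightarrow> category (A x)"
    and t_functor: "\<xi> \<in> arr X \<Longrightarrow> cat_functor (A (src X \<xi>)) (A (tgt X \<xi>)) (t \<xi>)"
    and \<mu>_trans: "\<lbrakk>\<xi> \<in> arr X; \<zeta> \<in> arr X; tgt X \<xi> = src X \<zeta>\<rbrakk> \<Longrightarrow>
          nat_trans (A (src X \<xi>)) (A (tgt X \<zeta>))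
            (comp_fun (A (src X \<xi>)) (t \<zeta>) (t \<xi>)) (t (\<zeta> \<cdot>\<^bsub>X\<^esub> \<xi>)) (\<mu> \<xi> \<zeta>)"
    and \<eta>_trans: "x \<in> obj X \<Longrightarrow>
          nat_trans (A x) (A x) (id_fun (A x)) (t (ident X x)) (\<eta> x)"
    and lax_assoc:
      "\<lbrakk>\<xi> \<in> arr X; \<zeta> \<in> arr X; \<tau> \<in> arr X; tgt X \<xi> = src X \<zeta>; tgt X \<zeta> = src X \<tau>\<rbrakk> \<Longrightarrow>
        vcomp (A (src X \<xi>)) (A (tgt X \<tau>))
          (\<mu> \<xi> (\<tau> \<cdot>\<^bsub>X\<^esub> \<zeta>)) (whisker_right (A (src X \<xi>)) (\<mu> \<zeta> \<tau>) (t \<xi>)) =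
        vcomp (A (src X \<xi>)) (A (tgt X \<tau>))
          (\<mu> (\<zeta> \<cdot>\<^bsub>X\<^esub> \<xi>) \<tau>) (whisker_left (A (src X \<xi>)) (t \<tau>) (\<mu> \<xi> \<zeta>))"
    and lax_unit_right:
      "\<xi> \<in> arr X \<Longrightarrow>
        vcomp (A (src X \<xi>)) (A (tgt X \<xi>))
          (\<mu> (ident X (src X \<xi>)) \<xi>) (whisker_left (A (src X \<xi>)) (t \<xi>) (\<eta> (src X \<xi>))) =
        id_trans (A (src X \<xi>)) (A (tgt X \<xi>)) (t \<xi>)"
    and lax_unit_left:
      "\<xi> \<in> arr X \<Longrightarrow>
        vcomp (A (src X \<xi>)) (A (tgt X \<xi>))
          (\<mu> \<xi> (ident X (tgt X \<xi>))) (whisker_right (A (src X \<xi>)) (\<eta> (tgt X \<xi>)) (t \<xi>)) =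
        id_trans (A (src X \<xi>)) (A (tgt X \<xi>)) (t \<xi>)"

record ('x, 'a, 'o, 'm) lax_data =
  lax_A :: "'x \<Rightarrow> ('o, 'm) cat"
  lax_t :: "'a \<Rightarrow> ('o, 'm) cfun"
  lax_\<mu> :: "'a \<Rightarrow> 'a \<Rightarrow> 'o \<Rightarrow> 'm"
  lax_\<eta> :: "'x \<Rightarrow> 'o \<Rightarrow> 'm"

definition lax_functors :: "('x, 'a) cat \<Rightarrow> ('x, 'a, 'o, 'm) lax_data set" where
  "lax_functors X = {L. lax_functor X (lax_A L) (lax_t L) (lax_\<mu> L) (lax_\<eta> L)}"


section \<open>The category Iso\<close>

datatype iso_obj = IsoX | IsoY

text \<open>The unique arrow from \<open>a\<close> to \<open>b\<close> is the pair \<open>(a, b)\<close>.\<close>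

definition Iso :: "(iso_obj, iso_obj \<times> iso_obj) cat" where
  "Iso = \<lparr>obj = UNIV, arr = UNIV, src = fst, tgt = snd, ident = (\<lambda>a. (a, a)),
          comp = (\<lambda>g f. if snd f = fst g then (fst f, snd g) else undefined)\<rparr>"

abbreviation (input) iso_alpha :: "iso_obj \<times> iso_obj" where "iso_alpha \<equiv> (IsoX, IsoY)"
abbreviation (input) iso_beta :: "iso_obj \<times> iso_obj" where "iso_beta \<equiv> (IsoY, IsoX)"

lemma category_Iso: "category Iso"
  by unfold_locales (auto simp: Iso_def)


section \<open>Morita contexts\<close>

locale monad =
  fixes A :: "('o, 'm) cat" and T :: "('o, 'm) cfun" and \<mu> \<eta> :: "'o \<Rightarrow> 'm"
  assumes mult_trans: "nat_trans A A (comp_fun A T T) T \<mu>"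
    and unit_trans: "nat_trans A A (id_fun A) T \<eta>"
    and monad_assoc: "vcomp A A \<mu> (whisker_right A \<mu> T) = vcomp A A \<mu> (whisker_left A T \<mu>)"
    and monad_unit_right: "vcomp A A \<mu> (whisker_left A T \<eta>) = id_trans A A T"
    and monad_unit_left: "vcomp A A \<mu> (whisker_right A \<eta> T) = id_trans A A T"

text \<open>A left action \<open>\<rho> : TF \<rightarrow> F\<close> of a monad \<open>T\<close> on \<open>B\<close> on a functor \<open>F : A \<rightarrow> B\<close>.\<close>

locale left_action =
  fixes A B :: "('o, 'm) cat" and T :: "('o, 'm) cfun" and \<mu> \<eta> :: "'o \<Rightarrow> 'm"
    and F :: "('o, 'm) cfun" and \<rho> :: "'o \<Rightarrow> 'm"
  assumes left_action_trans: "nat_trans A B (comp_fun A T F) F \<rho>"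
    and left_action_assoc:
      "vcomp A B \<rho> (whisker_left A T \<rho>) = vcomp A B \<rho> (whisker_right A \<mu> F)"
    and left_action_unit: "vcomp A B \<rho> (whisker_right A \<eta> F) = id_trans A B F"

text \<open>A right action \<open>\<lambda> : FS \<rightarrow> F\<close> of a monad \<open>S\<close> on \<open>A\<close> on a functor \<open>F : A \<rightarrow> B\<close>.\<close>

locale right_action =
  fixes A B :: "('o, 'm) cat" and S :: "('o, 'm) cfun" and \<mu> \<eta> :: "'o \<Rightarrow> 'm"
    and F :: "('o, 'm) cfun" and lam :: "'o \<Rightarrow> 'm"
  assumes right_action_trans: "nat_trans A B (comp_fun A F S) F lam"
    and right_action_assoc:
      "vcomp A B lam (whisker_right A lam S) = vcomp A B lam (whisker_left A F \<mu>)"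
    and right_action_unit: "vcomp A B lam (whisker_left A F \<eta>) = id_trans A B F"

locale bimodule =
  S: monad A S \<mu>S \<eta>S + T: monad B T \<mu>T \<eta>T + F: cat_functor A B F +
  left_action A B T \<mu>T \<eta>T F l + right_action A B S \<mu>S \<eta>S F r
  for A B :: "('o, 'm) cat" and S :: "('o, 'm) cfun" and \<mu>S \<eta>S :: "'o \<Rightarrow> 'm"
    and T :: "('o, 'm) cfun" and \<mu>T \<eta>T :: "'o \<Rightarrow> 'm"
    and F :: "('o, 'm) cfun" and l r :: "'o \<Rightarrow> 'm" +
  assumes actions_commute:
    "vcomp A B r (whisker_right A l S) = vcomp A B l (whisker_left A T r)"

locale morita_context =
  Mx: monad Ax tx \<mu>x \<eta>x + My: monad Ay ty \<mu>y \<eta>y +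
  f: bimodule Ax Ay tx \<mu>x \<eta>x ty \<mu>y \<eta>y f rho_f lam_f +
  g: bimodule Ay Ax ty \<mu>y \<eta>y tx \<mu>x \<eta>x g lam_g rho_g
  for Ax Ay :: "('o, 'm) cat"
    and tx :: "('o, 'm) cfun" and \<mu>x \<eta>x :: "'o \<Rightarrow> 'm"
    and ty :: "('o, 'm) cfun" and \<mu>y \<eta>y :: "'o \<Rightarrow> 'm"
    and f g :: "('o, 'm) cfun"
    and rho_f lam_f rho_g lam_g :: "'o \<Rightarrow> 'm" +
  fixes \<epsilon>x \<epsilon>y :: "'o \<Rightarrow> 'm"
  assumes \<epsilon>x_trans: "nat_trans Ax Ax (comp_fun Ax g f) tx \<epsilon>x"
    and \<epsilon>y_trans: "nat_trans Ay Ay (comp_fun Ay f g) ty \<epsilon>y"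
    and \<epsilon>x_left:
      "vcomp Ax Ax \<epsilon>x (whisker_right Ax lam_g f) = vcomp Ax Ax \<mu>x (whisker_left Ax tx \<epsilon>x)"
    and \<epsilon>x_right:
      "vcomp Ax Ax \<epsilon>x (whisker_left Ax g lam_f) = vcomp Ax Ax \<mu>x (whisker_right Ax \<epsilon>x tx)"
    and \<epsilon>x_balanced:
      "vcomp Ax Ax \<epsilon>x (whisker_right Ax rho_g f) = vcomp Ax Ax \<epsilon>x (whisker_left Ax g rho_f)"
    and \<epsilon>y_left:
      "vcomp Ay Ay \<epsilon>y (whisker_right Ay rho_f g) = vcomp Ay Ay \<mu>y (whisker_left Ay ty \<epsilon>y)"
    and \<epsilon>y_right:
      "vcomp Ay Ay \<epsilon>y (whisker_left Ay f rho_g) = vcomp Ay Ay \<mu>y (whisker_right Ay \<epsilon>y ty)"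
    and \<epsilon>y_balanced:
      "vcomp Ay Ay \<epsilon>y (whisker_right Ay lam_f g) = vcomp Ay Ay \<epsilon>y (whisker_left Ay f lam_g)"
    and \<epsilon>_f:
      "vcomp Ax Ay rho_f (whisker_right Ax \<epsilon>y f) = vcomp Ax Ay lam_f (whisker_left Ax f \<epsilon>x)"
    and \<epsilon>_g:
      "vcomp Ay Ax lam_g (whisker_right Ay \<epsilon>x g) = vcomp Ay Ax rho_g (whisker_left Ay g \<epsilon>y)"

record ('o, 'm) morita_data =
  mor_Ax :: "('o, 'm) cat"
  mor_Ay :: "('o, 'm) cat"
  mor_tx :: "('o, 'm) cfun"
  mor_\<mu>x :: "'o \<Rightarrow> 'm"
  mor_\<eta>x :: "'o \<Rightarrow> 'm"
  mor_ty :: "('o, 'm) cfun"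
  mor_\<mu>y :: "'o \<Rightarrow> 'm"
  mor_\<eta>y :: "'o \<Rightarrow> 'm"
  mor_f :: "('o, 'm) cfun"
  mor_g :: "('o, 'm) cfun"
  mor_rho_f :: "'o \<Rightarrow> 'm"
  mor_lam_f :: "'o \<Rightarrow> 'm"
  mor_rho_g :: "'o \<Rightarrow> 'm"
  mor_lam_g :: "'o \<Rightarrow> 'm"
  mor_\<epsilon>x :: "'o \<Rightarrow> 'm"
  mor_\<epsilon>y :: "'o \<Rightarrow> 'm"

definition morita_contexts :: "('o, 'm) morita_data set" where
  "morita_contexts = {M. morita_context (mor_Ax M) (mor_Ay M)
     (mor_tx M) (mor_\<mu>x M) (mor_\<eta>x M) (mor_ty M) (mor_\<mu>y M) (mor_\<eta>y M)
     (mor_f M) (mor_g M) (mor_rho_f M) (mor_lam_f M) (mor_rho_g M) (mor_lam_g M)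
     (mor_\<epsilon>x M) (mor_\<epsilon>y M)}"

definition morita_of_lax ::
    "(iso_obj, iso_obj \<times> iso_obj, 'o, 'm) lax_data \<Rightarrow> ('o, 'm) morita_data" where
  "morita_of_lax L =
    (let t = lax_t L; \<mu> = lax_\<mu> L; \<eta> = lax_\<eta> L;
         \<alpha> = iso_alpha; \<beta> = iso_beta; i\<^sub>x = ident Iso IsoX; i\<^sub>y = ident Iso IsoY
     in \<lparr>mor_Ax = lax_A L IsoX, mor_Ay = lax_A L IsoY,
         mor_tx = t i\<^sub>x, mor_\<mu>x = \<mu> i\<^sub>x i\<^sub>x, mor_\<eta>x = \<eta> IsoX,
         mor_ty = t i\<^sub>y, mor_\<mu>y = \<mu> i\<^sub>y i\<^sub>y, mor_\<eta>y = \<eta> IsoY,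
         mor_f = t \<alpha>, mor_g = t \<beta>,
         mor_rho_f = \<mu> \<alpha> i\<^sub>y, mor_lam_f = \<mu> i\<^sub>x \<alpha>,
         mor_rho_g = \<mu> i\<^sub>y \<beta>, mor_lam_g = \<mu> \<beta> i\<^sub>x,
         mor_\<epsilon>x = \<mu> \<alpha> \<beta>, mor_\<epsilon>y = \<mu> \<beta> \<alpha>\<rparr>)"

end

theory Submission
  imports Defs
begin

text \<open>
  An arrow of \<open>Iso\<close> is a pair of objects, so a chain of \<open>n\<close> composable arrows is a string of
  \<open>n + 1\<close> letters from \<open>{x, y}\<close>.  The structure of a lax functor is therefore a family over short
  strings, and the theorem matches it with the data and axioms of a Morita context, one string
  at a time.  The eight strings \<open>abc\<close> index the components of \<open>\<mu>\<close>: the two multiplications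
  (\<open>xxx\<close>, \<open>yyy\<close>), the four actions (\<open>xyy\<close>, \<open>xxy\<close>, \<open>yyx\<close>, \<open>yxx\<close>) and the two pairings
  (\<open>xyx\<close>, \<open>yxy\<close>).  The eight unit laws, two for each string \<open>ab\<close>, are those of the two monads
  and of the four actions.  The sixteen strings \<open>abcd\<close> index the associativity laws:

  \<^item> \<open>xxxx\<close>: associativity of the monad;
  \<^item> \<open>xyyy\<close>, \<open>xxxy\<close>: associativity of the left and of the right action on \<open>f\<close>;
  \<^item> \<open>xxyy\<close>: the two actions on \<open>f\<close> commute;
  \<^item> \<open>xyxx\<close>, \<open>xxyx\<close>: \<open>\<epsilon>\<^sub>x\<close> respects the left and the right action of \<open>t\<^sub>x\<close>;
  \<^item> \<open>xyyx\<close>: \<open>\<epsilon>\<^sub>x\<close> is balanced;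
  \<^item> \<open>xyxy\<close>: the compatibility of \<open>\<epsilon>\<^sub>x\<close> and \<open>\<epsilon>\<^sub>y\<close> on \<open>fgf\<close>;

  and the other eight are their images under the exchange of \<open>x\<close> and \<open>y\<close>.  This is
  \<open>lax_functor_Iso_iff_morita\<close>.  A Morita context thus prescribes every value of a lax functor,
  except those of \<open>\<mu>\<close> at pairs that are not composable, where extensionality prescribes
  \<^term>\<open>undefined\<close>; hence the correspondence is bijective.
\<close>

lemma Iso_simps [simp]:
  "obj Iso = UNIV" "arr Iso = UNIV" "src Iso = fst" "tgt Iso = snd" "ident Iso a = (a, a)"
  "(b, c) \<cdot>\<^bsub>Iso\<^esub> (a, b) = (a, c)"
  by (simp_all add: Iso_def)

lemma all_iso_obj: "(\<forall>a. P a) \<longleftrightarrow> P IsoX \<and> P IsoY"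
  by (metis iso_obj.exhaust)

text \<open>
  Since every object and every pair of objects (an arrow) belongs to \<open>Iso\<close>, extensionality is
  a condition on \<open>\<mu>\<close> alone.
\<close>

lemma lax_functor_Iso_iff:
  "lax_functor Iso A t \<mu> \<eta> \<longleftrightarrow>
    (\<forall>a b c d. b \<noteq> c \<longrightarrow> \<mu> (a, b) (c, d) = undefined) \<and>
    (\<forall>a. category (A a)) \<and>
    (\<forall>a b. cat_functor (A a) (A b) (t (a, b))) \<and>
    (\<forall>a b c. nat_trans (A a) (A c) (comp_fun (A a) (t (b, c)) (t (a, b))) (t (a, c))
      (\<mu> (a, b) (b, c))) \<and>
    (\<forall>a. nat_trans (A a) (A a) (id_fun (A a)) (t (a, a)) (\<eta> a)) \<and>
    (\<forall>a b c d.
      vcomp (A a) (A d) (\<mu> (a, b) (b, d)) (whisker_right (A a) (\<mu> (b, c) (c, d)) (t (a, b))) =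
      vcomp (A a) (A d) (\<mu> (a, c) (c, d)) (whisker_left (A a) (t (c, d)) (\<mu> (a, b) (b, c)))) \<and>
    (\<forall>a b. vcomp (A a) (A b) (\<mu> (a, a) (a, b)) (whisker_left (A a) (t (a, b)) (\<eta> a)) =
      id_trans (A a) (A b) (t (a, b))) \<and>
    (\<forall>a b. vcomp (A a) (A b) (\<mu> (a, b) (b, b)) (whisker_right (A a) (\<eta> b) (t (a, b))) =
      id_trans (A a) (A b) (t (a, b)))"
  unfolding lax_functor_def lax_functor_axioms_def
  by (simp add: category_Iso)

lemma nat_trans_codomain:
  assumes "nat_trans A B F G \<sigma>"
  shows "cat_functor A B G"
proof -
  interpret nat_trans A B F G \<sigma> by (fact assms)
  show ?thesis by unfold_locales
qed

lemma cat_functor_domain: "cat_functor A B F \<Longrightarrow> category A"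
  by (simp add: cat_functor_def)

lemma lax_functor_Iso_iff_morita:
  fixes A :: "iso_obj \<Rightarrow> ('o, 'm) cat"
  shows "lax_functor Iso A t \<mu> \<eta> \<longleftrightarrow>
    (\<forall>a b c d. b \<noteq> c \<longrightarrow> \<mu> (a, b) (c, d) = undefined) \<and>
    morita_context (A IsoX) (A IsoY)
      (t (IsoX, IsoX)) (\<mu> (IsoX, IsoX) (IsoX, IsoX)) (\<eta> IsoX)
      (t (IsoY, IsoY)) (\<mu> (IsoY, IsoY) (IsoY, IsoY)) (\<eta> IsoY)
      (t iso_alpha) (t iso_beta)
      (\<mu> iso_alpha (IsoY, IsoY)) (\<mu> (IsoX, IsoX) iso_alpha)
      (\<mu> (IsoY, IsoY) iso_beta) (\<mu> iso_beta (IsoX, IsoX))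
      (\<mu> iso_alpha iso_beta) (\<mu> iso_beta iso_alpha)"
    (is "_ \<longleftrightarrow> ?U \<and> ?M")
proof
  assume "lax_functor Iso A t \<mu> \<eta>"
  note L = this [unfolded lax_functor_Iso_iff]
  show "?U \<and> ?M"
    unfolding morita_context_def morita_context_axioms_def bimodule_def bimodule_axioms_def
      monad_def left_action_def right_action_def
    using L by simp
next
  assume R: "?U \<and> ?M"
  then interpret morita_context "A IsoX" "A IsoY"
      "t (IsoX, IsoX)" "\<mu> (IsoX, IsoX) (IsoX, IsoX)" "\<eta> IsoX"
      "t (IsoY, IsoY)" "\<mu> (IsoY, IsoY) (IsoY, IsoY)" "\<eta> IsoY"
      "t iso_alpha" "t iso_beta"
      "\<mu> iso_alpha (IsoY, IsoY)" "\<mu> (IsoX, IsoX) iso_alpha"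
      "\<mu> (IsoY, IsoY) iso_beta" "\<mu> iso_beta (IsoX, IsoX)"
      "\<mu> iso_alpha iso_beta" "\<mu> iso_beta iso_alpha"
    by simp
  \<comment> \<open>A monad is given only by natural transformations, so its endofunctor and its base category
    are recovered from the unit.\<close>
  note functors = nat_trans_codomain [OF Mx.unit_trans] nat_trans_codomain [OF My.unit_trans]
    f.F.cat_functor_axioms g.F.cat_functor_axioms
  show "lax_functor Iso A t \<mu> \<eta>"
    unfolding lax_functor_Iso_iff
  proof (intro conjI)
    show ?U using R by simp
  qed (simp_all only: all_iso_obj functors functors [THEN cat_functor_domain] simp_thms
      Mx.mult_trans Mx.unit_trans Mx.monad_assoc Mx.monad_unit_left Mx.monad_unit_right
      My.mult_trans My.unit_trans My.monad_assoc My.monad_unit_left My.monad_unit_right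
      f.left_action_trans f.left_action_assoc f.left_action_unit
      f.right_action_trans f.right_action_assoc f.right_action_unit f.actions_commute
      g.left_action_trans g.left_action_assoc g.left_action_unit
      g.right_action_trans g.right_action_assoc g.right_action_unit g.actions_commute
      \<epsilon>x_trans \<epsilon>x_left \<epsilon>x_right \<epsilon>x_balanced \<epsilon>y_trans \<epsilon>y_left \<epsilon>y_right \<epsilon>y_balanced \<epsilon>_f \<epsilon>_g)
qed

definition lax_of_morita ::
    "('o, 'm) morita_data \<Rightarrow> (iso_obj, iso_obj \<times> iso_obj, 'o, 'm) lax_data" where
  "lax_of_morita M =
    \<lparr>lax_A = case_iso_obj (mor_Ax M) (mor_Ay M),
     lax_t = (\<lambda>(a, b).
       case_iso_obj (case_iso_obj (mor_tx M) (mor_f M) b) (case_iso_obj (mor_g M) (mor_ty M) b) a),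
     lax_\<mu> = (\<lambda>(a, b) (b', c). if b \<noteq> b' then undefined else
       case_iso_obj
         (case_iso_obj (case_iso_obj (mor_\<mu>x M) (mor_lam_f M) c)
           (case_iso_obj (mor_\<epsilon>x M) (mor_rho_f M) c) b)
         (case_iso_obj (case_iso_obj (mor_lam_g M) (mor_\<epsilon>y M) c)
           (case_iso_obj (mor_rho_g M) (mor_\<mu>y M) c) b) a),
     lax_\<eta> = case_iso_obj (mor_\<eta>x M) (mor_\<eta>y M)\<rparr>"

lemma morita_of_lax_of_morita: "morita_of_lax (lax_of_morita M) = M"
  by (simp add: morita_of_lax_def lax_of_morita_def Let_def)

lemma lax_of_morita_of_lax:
  assumes "\<And>a b c d. b \<noteq> c \<Longrightarrow> lax_\<mu> L (a, b) (c, d) = undefined"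
  shows "lax_of_morita (morita_of_lax L) = L"
  by (rule lax_data.equality)
    (auto simp: morita_of_lax_def lax_of_morita_def Let_def fun_eq_iff assms split: iso_obj.split)

lemma lax_functors_Iso_iff:
  "L \<in> lax_functors Iso \<longleftrightarrow>
    (\<forall>a b c d. b \<noteq> c \<longrightarrow> lax_\<mu> L (a, b) (c, d) = undefined) \<and> morita_of_lax L \<in> morita_contexts"
  by (simp add: lax_functors_def morita_contexts_def morita_of_lax_def Let_def
      lax_functor_Iso_iff_morita)

theorem mainTheorem1:
  shows "bij_betw morita_of_lax
    (lax_functors Iso :: (iso_obj, iso_obj \<times> iso_obj, 'o, 'm) lax_data set)
    (morita_contexts :: ('o, 'm) morita_data set)"
proof (rule bij_betw_byWitness [where f' = lax_of_morita])
  show "\<forall>L \<in> lax_functors Iso. lax_of_morita (morita_of_lax L) = L"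
    by (simp add: lax_functors_Iso_iff lax_of_morita_of_lax)
  show "\<forall>M \<in> morita_contexts. morita_of_lax (lax_of_morita M) = M"
    by (simp add: morita_of_lax_of_morita)
  show "morita_of_lax ` lax_functors Iso \<subseteq> morita_contexts"
    by (auto simp: lax_functors_Iso_iff)
  show "lax_of_morita ` morita_contexts \<subseteq> lax_functors Iso"
    by (auto simp: lax_functors_Iso_iff morita_of_lax_of_morita) (simp add: lax_of_morita_def)
qed

end
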